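(* Let $\{\bar X_k\}_{k=0}^N$ and $\{\widetilde X_k\}_{k=0}^N$ be the two Markov chains generated by the one-step mappings $\bar X_{t,x}(t+h)$ and $\widetilde X_{t,x}(t+h)$ as described in the context. Assume: (A1) For some $p\ge1$, there exist $p_2\ge\frac12$, $p_1\ge p_2+\frac12$, $\alpha\ge1$, $h_0\in(0,1]$ and $K_1>0$ such that for all $t\in[t_0,T-h]$, $x\in\mathbb R^d$ and $h\in(0,h_0]$, $$\big|\mathbf E\big(\bar X_{t,x}(t+h)-\widetilde X_{t,x}(t+h)\big)\big|\le K_1(1+|x|^{2\alpha})^{1/2}h^{p_1},$$ $$\big[\mathbf E\big|\bar X_{t,x}(t+h)-\widetilde X_{t,x}(t+h)\big|^{2p}\big]^{1/(2p)}\le K_1(1+|x|^{2\alpha p})^{1/(2p)}h^{p_2}.$$ (A2) For any $q\ge1$ there is $K_2(q)>0$ such that for all $h\in(0,h_0]$ and $k=0,1,\dots,N$, $\ \mathbf E|\bar X_k|^q+\mathbf E|\widetilde X_k|^q\le K_2(q)$. (A3) There is a representation $\widetilde X_{t,x}(t+h)-\widetilde X_{t,y}(t+h)=x-y+V$ for which $$\mathbf E\big|\widetilde X_{t,x}(t+h)-\widetilde X_{t,y}(t+h)\big|^{2p}\le|x-y|^{2p}(1+Kh),\qquad \mathbf E|V|^{2p}\le K(1+|x|^{p\beta}+|y|^{p\beta})|x-y|^{2p}h^p,$$ where $\beta\ge1$ is a constant (and $K$ does not depend on $t\in[t_0,T-h]$, $x,y\in\mathbb R^d$, $h\in(0,h_0]$).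 Then there is a constant $K$ independent of $h$ such that for any $h\in(0,h_0]$ and $k=0,\dots,N$, $$\big[\mathbf E|\bar X_k-\widetilde X_k|^{2p}\big]^{1/(2p)}\le Kh^{p_2-1/2}.$$
   Context: Let $\mathbf W$ be an $m$-dimensional standard Brownian motion with respect to a filtration $\{\mathcal F_t\}$ satisfying the usual conditions on $(\Omega,\mathcal F,\mathbf P)$. Let $t_0<t_1<\dots<t_N=T$ be the uniform partition of $[t_0,T]$ with step $h=(T-t_0)/N$, $N\in\mathbb N^+$. The one-step mappings are $$\bar X_{t,x}(t+h)=x+\bar A(t,x,h;\mathbf W(s)-\mathbf W(t),\,t\le s\le t+h),\qquad \widetilde X_{t,x}(t+h)=x+\widetilde A(t,x,h;\mathbf W(s)-\mathbf W(t),\,t\le s\le t+h),$$ where $\bar A,\widetilde A$ are $\mathbb R^d$-valued measurable functions of $(t,x,h)$ and of the path of Brownian increments on $[t,t+h]$. The chains are $\bar X_0=\widetilde X_0\in\mathbf L^2(\Omega,\mathcal F,\mathbf P;\mathbb R^d)$, $\mathcal F_{t_0}$-measurable, and $\bar X_{k+1}=\bar X_{t_k,\bar X_k}(t_{k+1})$, $\widetilde X_{k+1}=\widetilde X_{t_k,\widetilde X_k}(t_{k+1})$, i.e. $$\bar X_{k+1}=\bar X_k+\bar A(t_k,\bar X_k,h;\mathbf W(s)-\mathbf W(t_k),t_k\le s\le t_{k+1}),\quad \widetilde X_{k+1}=\widetilde X_k+\widetilde A(t_k,\widetilde X_k,h;\mathbf W(s)-\mathbf W(t_k),t_k\le s\le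 t_{k+1}),$$ $k=0,\dots,N-1$. *)

theory Defs
  imports "HOL-Probability.Probability"
begin

text \<open>
  Time is \<open>[0,\<infinity>)\<close>, represented by the nonnegative reals. The library's \<open>filtration\<close> is indexed by
  a whole type, so \<open>F t\<close> also exists for \<open>t < 0\<close>; those members carry no information (a filtration
  on \<open>[0,\<infinity>)\<close> is extended by \<open>F t = F 0\<close>).
\<close>

definition usual_conditions :: "'a measure \<Rightarrow> (real \<Rightarrow> 'a measure) \<Rightarrow> bool" where
  "usual_conditions M F \<longleftrightarrow>
     filtration (space M) F \<and>
     (\<forall>t. subalgebra M (F t)) \<and>
     complete_measure M \<and>
     null_sets M \<subseteq> sets (F 0) \<and>
     (\<forall>t\<ge>0. sets (F t) = (\<Inter>s\<in>{t<..}. sets (F s)))"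

definition standard_brownian_motion ::
  "'a measure \<Rightarrow> (real \<Rightarrow> 'a measure) \<Rightarrow> (real \<Rightarrow> 'a \<Rightarrow> real ^ ('m::finite)) \<Rightarrow> bool" where
  "standard_brownian_motion M F W \<longleftrightarrow>
     (\<forall>t\<ge>0. W t \<in> borel_measurable (F t)) \<and>
     (AE \<omega> in M. W 0 \<omega> = 0) \<and>
     (\<forall>\<omega>\<in>space M. continuous_on {0..} (\<lambda>t. W t \<omega>)) \<and>
     (\<forall>s t. 0 \<le> s \<and> s < t \<longrightarrow>
        prob_space.indep_set M (sets (F s))
          (sets (vimage_algebra (space M) (\<lambda>\<omega>. W t \<omega> - W s \<omega>) borel)) \<and>
        distributed M lborel (\<lambda>\<omega>. W t \<omega> - W s \<omega>)
          (\<lambda>x. ennreal (\<Prod>i\<in>UNIV. normal_density 0 (sqrt (t - s)) (x $ i))))"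

text \<open>
  The space of continuous paths with the \<open>\<sigma>\<close>-algebra generated by the coordinate evaluations.
\<close>

definition path_space :: "(real \<Rightarrow> real ^ ('m::finite)) measure" where
  "path_space = restrict_space (\<Pi>\<^sub>M s\<in>UNIV. borel) {w. continuous_on UNIV w}"

text \<open>
  The path \<open>s \<mapsto> W s - W t\<close> on \<open>[t, t + h]\<close>, continued by its end values outside of this interval. It
  depends only on the increments on \<open>[t, t + h]\<close>, and it lets the paths for all \<open>t\<close> and \<open>h\<close> live in
  the single space \<open>path_space\<close>, so that joint measurability in \<open>(t, x, h)\<close> and the path makes sense.
\<close>

definition increment_path ::
  "(real \<Rightarrow> 'a \<Rightarrow> real ^ ('m::finite)) \<Rightarrow> real \<Rightarrow> real \<Rightarrow> 'a \<Rightarrow> real \<Rightarrow> real ^ 'm" where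
  "increment_path W t h \<omega> = ext_cont (\<lambda>s. W s \<omega> - W t \<omega>) t (t + h)"

type_synonym ('d, 'm) increment_fun =
  "real \<Rightarrow> real ^ 'd \<Rightarrow> real \<Rightarrow> (real \<Rightarrow> real ^ 'm) \<Rightarrow> real ^ 'd"

definition measurable_increment_fun :: "('d::finite, 'm::finite) increment_fun \<Rightarrow> bool" where
  "measurable_increment_fun A \<longleftrightarrow>
     (\<lambda>(t, x, h, w). A t x h w)
       \<in> borel \<Otimes>\<^sub>M borel \<Otimes>\<^sub>M borel \<Otimes>\<^sub>M path_space \<rightarrow>\<^sub>M borel"

definition one_step ::
  "('d::finite, 'm::finite) increment_fun \<Rightarrow> (real \<Rightarrow> 'a \<Rightarrow> real ^ 'm) \<Rightarrow> real \<Rightarrow> real ^ 'd \<Rightarrow> real \<Rightarrow> 'a \<Rightarrow> real ^ 'd"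
  where
  "one_step A W t x h \<omega> = x + A t x h (increment_path W t h \<omega>)"

primrec chain ::
  "('d::finite, 'm::finite) increment_fun \<Rightarrow> (real \<Rightarrow> 'a \<Rightarrow> real ^ 'm) \<Rightarrow> real \<Rightarrow> real \<Rightarrow> ('a \<Rightarrow> real ^ 'd) \<Rightarrow> nat
     \<Rightarrow> 'a \<Rightarrow> real ^ 'd" where
  "chain A W t0 h X0 0 \<omega> = X0 \<omega>"
| "chain A W t0 h X0 (Suc k) \<omega> =
     one_step A W (t0 + real k * h) (chain A W t0 h X0 k \<omega>) h \<omega>"

text \<open>
  Since the Bochner integral of a non-integrable function is \<open>0\<close>, a bound on \<open>moment M q X\<close> means
  what it should only together with \<open>finite_moment M q X\<close>.
\<close>

definition finite_moment :: "'a measure \<Rightarrow> real \<Rightarrow> ('a \<Rightarrow> real ^ ('d::finite)) \<Rightarrow> bool" where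
  "finite_moment M q X \<longleftrightarrow> integrable M (\<lambda>\<omega>. norm (X \<omega>) powr q)"

definition moment :: "'a measure \<Rightarrow> real \<Rightarrow> ('a \<Rightarrow> real ^ ('d::finite)) \<Rightarrow> real" where
  "moment M q X = (\<integral>\<omega>. norm (X \<omega>) powr q \<partial>M)"

end

theory Submission
  imports Defs
begin

text \<open>
  Put \<open>q = 2 p\<close>, \<open>\<delta> = h powr (p2 - 1/2)\<close> and let \<open>e\<close> be the difference of the two chains at time \<open>t\<^sub>k\<close>.
  At the next time it is \<open>e + V + R\<close>, where \<open>R\<close> is the local error of the two mappings at the same
  point and \<open>V\<close> is the one from (A3). The subgradient inequality for \<open>\<bar>z\<bar>\<^sup>q\<close> and a Lipschitz
  bound for its gradient give
  \<open>\<bar>e + V + R\<bar>\<^sup>q \<le> \<bar>e + V\<bar>\<^sup>q + q \<bar>e\<bar> powr (q - 2) \<langle>e, R\<rangle>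
    + q (q - 1) \<bar>R\<bar> (\<bar>R\<bar> + \<bar>V\<bar>) (\<bar>e\<bar> + \<bar>V\<bar> + \<bar>R\<bar>) powr (q - 2)\<close>.
  The increment of the Brownian path is independent of the past, so expectations can be taken for
  fixed values of the two chains: the first term is controlled by (A3), the second one by the bound
  on the mean of \<open>R\<close>, the third one by the moments of \<open>R\<close> and \<open>V\<close>. Young's inequality and (A2) turn
  this into \<open>a\<^sub>k\<^sub>+\<^sub>1 \<le> (1 + C h) a\<^sub>k + C h \<delta>\<^sup>q\<close> for the \<open>q\<close>-th moments \<open>a\<^sub>k\<close> of the error.
\<close>

section \<open>Moments of one step\<close>

lemma weighted_am_gm_powr:
  fixes n x y :: real
  assumes "1 \<le> n" "0 \<le> x" "0 \<le> y"
  shows "n * (x powr (n - 1) * y) \<le> (n - 1) * x powr n + y powr n"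
proof (cases "n = 1")
  case True
  with assms show ?thesis by (cases "x = 0") auto
next
  case False
  with assms have n: "1 < n" by simp
  \<comment> \<open>Young's inequality with the conjugate exponents \<open>n\<close> and
    \<open>n / (n - 1)\<close>, the second of which is undefined for \<open>n = 1\<close>.
    Multiplied by \<open>n\<close> it is the tangent-line inequality of the convex function
    \<open>y powr n\<close> at the point \<open>x\<close>, sharp for \<open>x = y\<close>.\<close>
  have "y * x powr (n - 1) \<le> y powr n / n + (x powr (n - 1)) powr (n / (n - 1)) / (n / (n - 1))"
    using assms n by (intro Youngs_inequality) (auto simp: field_simps)
  also have "(x powr (n - 1)) powr (n / (n - 1)) = x powr n"
    using n by (simp add: powr_powr)
  finally have "n * (y * x powr (n - 1)) \<le> n * (y powr n / n + x powr n / (n / (n - 1)))"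
    using n by (intro mult_left_mono) auto
  also have "\<dots> = (n - 1) * x powr n + y powr n"
    using n by (simp add: field_simps)
  finally show ?thesis by (simp add: mult.commute)
qed

lemma mult_powr_le:
  fixes x y q :: real
  assumes "1 \<le> q" "0 \<le> x" "0 \<le> y"
  shows "x powr (q - 1) * y \<le> x powr q + y powr q"
proof -
  have "q * (x powr (q - 1) * y) \<le> (q - 1) * x powr q + y powr q"
    using assms by (rule weighted_am_gm_powr)
  also have "\<dots> \<le> q * (x powr q + y powr q)"
    unfolding left_diff_distrib distrib_left
    using mult_right_mono[OF assms(1) powr_ge_zero[of y q]] powr_ge_zero[of x q] by linarith
  finally show ?thesis using assms by simp
qed

lemma powr_add3_le:
  fixes a b c q :: real
  assumes "0 \<le> q" "0 \<le> a" "0 \<le> b" "0 \<le> c"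
  shows "(a + b + c) powr q \<le> 3 powr q * (a powr q + b powr q + c powr q)"
proof -
  have "(a + b + c) powr q \<le> (3 * max a (max b c)) powr q"
    using assms by (intro powr_mono2) auto
  also have "\<dots> = 3 powr q * (max a (max b c)) powr q"
    using assms by (simp add: powr_mult)
  also have "\<dots> \<le> 3 powr q * (a powr q + b powr q + c powr q)"
    by (intro mult_left_mono) (auto simp: max_def)
  finally show ?thesis .
qed

lemma powr_add2_le:
  fixes a b q :: real
  assumes "0 \<le> q" "0 \<le> a" "0 \<le> b"
  shows "(a + b) powr q \<le> 2 powr q * (a powr q + b powr q)"
proof -
  have "(a + b) powr q \<le> (2 * max a b) powr q"
    using assms by (intro powr_mono2) auto
  also have "\<dots> = 2 powr q * (max a b) powr q"
    using assms by (simp add: powr_mult)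
  also have "\<dots> \<le> 2 powr q * (a powr q + b powr q)"
    by (intro mult_left_mono) (auto simp: max_def)
  finally show ?thesis .
qed

section \<open>Expansion of the \<open>q\<close>-th power of the norm\<close>

lemma norm_powr_subgradient:
  fixes a b :: "'b::real_inner"
  assumes "2 \<le> q"
  shows "norm b powr q \<le> norm a powr q + q * (norm b powr (q - 2) *\<^sub>R b \<bullet> (b - a))"
proof -
  have sq: "(b \<bullet> b) * norm b powr (q - 2) = norm b powr q"
  proof (cases "b = 0")
    case False
    then have "b \<bullet> b = norm b powr 2" by (simp add: power2_norm_eq_inner)
    moreover have "norm b powr q = norm b powr (q - 2) * norm b powr 2"
      using powr_add[of "norm b" "q - 2" 2] by simp
    ultimately show ?thesis by simp
  qed simp
  \<comment> \<open>Up to the factor \<open>q\<close>, the vector paired with \<open>b - a\<close>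
    is the gradient of the \<open>q\<close>-th power of the norm at \<open>b\<close>. Cauchy-Schwarz
    reduces convexity in the inner product space to the scalar tangent line at
    \<open>norm b\<close>.\<close>
  have "norm b powr (q - 2) * (b \<bullet> a) \<le> norm b powr (q - 2) * (norm b * norm a)"
    by (intro mult_left_mono norm_cauchy_schwarz) simp
  also have "\<dots> = norm b powr (q - 1) * norm a"
    using powr_add[of "norm b" "q - 2" 1] by (simp add: algebra_simps)
  finally have "q * (norm b powr (q - 2) * (b \<bullet> a)) \<le> q * (norm b powr (q - 1) * norm a)"
    using assms by (intro mult_left_mono) auto
  also have "\<dots> \<le> (q - 1) * norm b powr q + norm a powr q"
    using assms by (intro weighted_am_gm_powr) auto
  finally show ?thesis
    by (simp add: inner_diff_right right_diff_distrib sq algebra_simps)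
qed

text \<open>With \<open>s = q - 2\<close> this controls the change of the gradient of the
  \<open>q\<close>-th power of the norm on the ball of radius \<open>c\<close>. If \<open>b\<close>
  is the shorter vector, the difference splits into \<open>norm a powr s\<close> times
  \<open>a - b\<close> and a multiple of \<open>b\<close>; the tangent line for the exponent
  \<open>s + 1\<close> at \<open>norm a\<close> bounds the latter.\<close>

lemma norm_powr_scaleR_lipschitz:
  fixes a b :: "'b::real_inner"
  assumes "0 \<le> s" "norm a \<le> c" "norm b \<le> c"
  shows "norm (norm a powr s *\<^sub>R a - norm b powr s *\<^sub>R b) \<le> (s + 1) * norm (a - b) * c powr s"
proof -
  have *: "norm (norm a powr s *\<^sub>R a - norm b powr s *\<^sub>R b) \<le> (s + 1) * norm (a - b) * c powr s"
    if le: "norm b \<le> norm a" and c: "norm a \<le> c" for a b :: 'b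
  proof -
    have "(s + 1) * (norm a powr (s + 1 - 1) * norm b) \<le>
        (s + 1 - 1) * norm a powr (s + 1) + norm b powr (s + 1)"
      using assms by (intro weighted_am_gm_powr) auto
    then have "(norm a powr s - norm b powr s) * norm b \<le> s * norm a powr s * (norm a - norm b)"
      by (simp add: powr_add algebra_simps)
    also have "\<dots> \<le> s * norm a powr s * norm (a - b)"
      using assms by (intro mult_left_mono norm_triangle_ineq2) auto
    finally have 1: "(norm a powr s - norm b powr s) * norm b \<le> s * norm a powr s * norm (a - b)" .
    have "norm (norm a powr s *\<^sub>R a - norm b powr s *\<^sub>R b)
        = norm (norm a powr s *\<^sub>R (a - b) + (norm a powr s - norm b powr s) *\<^sub>R b)"
      by (simp add: algebra_simps)
    also have "\<dots> \<le> norm a powr s * norm (a - b) + (norm a powr s - norm b powr s) * norm b"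
      using norm_triangle_ineq[of "norm a powr s *\<^sub>R (a - b)" "(norm a powr s - norm b powr s) *\<^sub>R b"]
        powr_mono2[of s "norm b" "norm a"] assms le by simp
    also have "\<dots> \<le> (s + 1) * norm (a - b) * norm a powr s"
      using 1 by (simp add: algebra_simps)
    also have "\<dots> \<le> (s + 1) * norm (a - b) * c powr s"
      using assms c by (intro mult_left_mono powr_mono2) auto
    finally show ?thesis .
  qed
  show ?thesis
    using *[of a b] *[of b a] assms by (cases "norm a \<le> norm b") (auto simp: norm_minus_commute)
qed

text \<open>Convexity gives an upper bound only with the gradient at the end point
  \<open>e + v + r\<close>. Moving it back to \<open>e\<close>, at a distance of at most
  \<open>norm r + norm v\<close>, costs the remainder, but leaves a term linear in \<open>r\<close>
  whose expectation for fixed \<open>e\<close> sees only the mean of \<open>r\<close>.\<close>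

lemma norm_powr_expansion:
  fixes e v r :: "'b::real_inner"
  assumes "2 \<le> q"
  shows "norm (e + v + r) powr q \<le> norm (e + v) powr q + q * norm e powr (q - 2) * (e \<bullet> r)
     + q * (q - 1) * norm r * (norm r + norm v) * (norm e + norm v + norm r) powr (q - 2)"
proof -
  define b where "b = e + v + r"
  let ?c = "norm e + norm v + norm r"
  have nb: "norm b \<le> ?c"
    unfolding b_def by (meson add_right_mono norm_triangle_ineq norm_triangle_le order_trans)
  have be: "norm (b - e) \<le> norm r + norm v"
    unfolding b_def using norm_triangle_ineq[of v r] by (simp add: algebra_simps)
  let ?g = "\<lambda>z. norm z powr (q - 2) *\<^sub>R z"
  have "norm (?g b - ?g e) \<le> (q - 2 + 1) * norm (b - e) * ?c powr (q - 2)"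
    using assms nb by (intro norm_powr_scaleR_lipschitz) auto
  also have "\<dots> \<le> (q - 1) * (norm r + norm v) * ?c powr (q - 2)"
    using assms be by (intro mult_right_mono) auto
  finally have g: "norm (?g b - ?g e) \<le> (q - 1) * (norm r + norm v) * ?c powr (q - 2)" .
  have "(?g b - ?g e) \<bullet> r \<le> norm (?g b - ?g e) * norm r"
    by (rule norm_cauchy_schwarz)
  also have "\<dots> \<le> (q - 1) * (norm r + norm v) * ?c powr (q - 2) * norm r"
    using g by (rule mult_right_mono) simp
  finally have 2: "q * (?g b \<bullet> r) \<le> q * (?g e \<bullet> r + (q - 1) * (norm r + norm v) * ?c powr (q - 2) * norm r)"
    using assms by (intro mult_left_mono) (auto simp: inner_diff_left)
  have "norm b powr q \<le> norm (e + v) powr q + q * (?g b \<bullet> (b - (e + v)))"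
    using assms by (rule norm_powr_subgradient)
  also have "b - (e + v) = r" by (simp add: b_def)
  finally show ?thesis using 2 by (simp add: b_def algebra_simps)
qed

text \<open>
  The scaling \<open>r \<sim> \<surd>h \<delta>\<close>, \<open>v \<sim> \<surd>h \<bar>e\<bar>\<close> is that of the local error and of the increment of the
  difference of two solutions; it turns the remainder of the expansion into a single term of order
  \<open>h \<delta>\<close>, so that no Hoelder inequality is needed after taking expectations.
  For \<open>e = 0\<close> the last quotient is \<open>0\<close>, which is correct because then \<open>v = 0\<close>.
\<close>
lemma norm_powr_expansion_scaled:
  fixes e v r :: "'b::real_inner"
  assumes q: "2 \<le> q" and h: "0 < h" "h \<le> 1" and d: "0 < d" and ev: "e = 0 \<Longrightarrow> v = 0"
  shows "norm (e + v + r) powr q \<le> norm (e + v) powr q + q * norm e powr (q - 2) * (e \<bullet> r)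
     + q * (q - 1) * 3 powr q * h * d * (d + norm e) powr (q - 1)
       * (1 + norm r powr q / (sqrt h * d) powr q + norm v powr q / (sqrt h * norm e) powr q)"
proof -
  define \<rho> where "\<rho> = norm r / (sqrt h * d)"
  define \<nu> where "\<nu> = norm v / (sqrt h * norm e)"
  have pos: "0 \<le> \<rho>" "0 \<le> \<nu>" "sqrt h \<le> 1" "0 < sqrt h" using h d by (auto simp: \<rho>_def \<nu>_def)
  have r: "norm r = sqrt h * d * \<rho>" using h d by (simp add: \<rho>_def)
  have v: "norm v = sqrt h * norm e * \<nu>" using h ev by (cases "e = 0") (auto simp: \<nu>_def)
  let ?u = "norm e" and ?s = "1 + \<rho> + \<nu>"
  have a: "norm r + norm v \<le> sqrt h * ((d + ?u) * ?s)"
    unfolding r v using pos d by (simp add: algebra_simps)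
  \<comment> \<open>In the factor with exponent \<open>q - 2\<close> no power of \<open>h\<close>
    has to be gained, so \<open>sqrt h \<le> 1\<close> suffices.\<close>
  have "?u + norm v + norm r \<le> ?u + 1 * (?u * \<nu>) + 1 * (d * \<rho>)"
    unfolding r v mult.assoc using pos d by (intro add_mono mult_right_mono) auto
  also have "\<dots> \<le> (d + ?u) * ?s"
    using pos d by (simp add: algebra_simps)
  finally have b: "?u + norm v + norm r \<le> (d + ?u) * ?s" .
  \<comment> \<open>The factors \<open>norm r\<close> and \<open>norm r + norm v\<close> contribute
    one \<open>sqrt h\<close> each, which makes \<open>h\<close>. The powers of
    \<open>d + norm e\<close> add up to \<open>q - 1\<close>, those of
    \<open>1 + \<rho> + \<nu>\<close> to \<open>q\<close>.\<close>
  have "norm r * (norm r + norm v) * (?u + norm v + norm r) powr (q - 2)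
      \<le> (sqrt h * d * ?s) * (sqrt h * ((d + ?u) * ?s)) * ((d + ?u) * ?s) powr (q - 2)"
  proof (intro mult_mono powr_mono2 a b)
    show "norm r \<le> sqrt h * d * ?s" unfolding r using pos d by (intro mult_left_mono) auto
  qed (use q pos d in auto)
  also have "\<dots> = h * d * (((d + ?u) * ((d + ?u) powr (q - 2))) * (?s * ?s * (?s powr (q - 2))))"
  proof -
    have "(a * d * s) * (a * (w * s)) * (w' * s') = (a * a) * d * ((w * w') * (s * s * s'))"
      for a s w w' s' :: real by (simp only: ac_simps)
    moreover have "sqrt h * sqrt h = h" using h by simp
    ultimately show ?thesis using pos d by (simp only: powr_mult)
  qed
  also have "(d + ?u) * ((d + ?u) powr (q - 2)) = (d + ?u) powr (q - 1)"
    using d powr_add[of "d + ?u" 1 "q - 2"] by (simp add: add_pos_nonneg)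
  also have "?s * ?s * (?s powr (q - 2)) = ?s powr q"
    using pos powr_add[of ?s 2 "q - 2"] by (simp add: power2_eq_square)
  finally have 1: "norm r * (norm r + norm v) * (?u + norm v + norm r) powr (q - 2)
      \<le> h * d * ((d + ?u) powr (q - 1) * ?s powr q)" .
  have 2: "?s powr q \<le> 3 powr q * (1 + \<rho> powr q + \<nu> powr q)"
    using powr_add3_le[of q 1 \<rho> \<nu>] pos q by simp
  have "norm r * (norm r + norm v) * (?u + norm v + norm r) powr (q - 2)
      \<le> h * d * ((d + ?u) powr (q - 1) * (3 powr q * (1 + \<rho> powr q + \<nu> powr q)))"
    using h d by (intro order_trans[OF 1] mult_left_mono 2) auto
  then have "q * (q - 1) * (norm r * (norm r + norm v) * (?u + norm v + norm r) powr (q - 2))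
      \<le> q * (q - 1) * (h * d * ((d + ?u) powr (q - 1) * (3 powr q * (1 + \<rho> powr q + \<nu> powr q))))"
    using q by (intro mult_left_mono) auto
  moreover have "\<rho> powr q = norm r powr q / (sqrt h * d) powr q"
    using h d by (simp add: \<rho>_def powr_divide)
  moreover have "\<nu> powr q = norm v powr q / (sqrt h * norm e) powr q"
    using h by (simp add: \<nu>_def powr_divide)
  ultimately show ?thesis
    using norm_powr_expansion[OF q, of e v r] by (simp add: mult.assoc mult.left_commute)
qed

section \<open>Expectations over one step from fixed starting points\<close>

lemma integrable_norm_powr_add:
  fixes f g :: "'a \<Rightarrow> 'b::euclidean_space"
  assumes "0 \<le> q" and [measurable]: "f \<in> borel_measurable M" "g \<in> borel_measurable M"
    and int: "integrable M (\<lambda>\<omega>. norm (f \<omega>) powr q)" "integrable M (\<lambda>\<omega>. norm (g \<omega>) powr q)"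
  shows "integrable M (\<lambda>\<omega>. norm (f \<omega> + g \<omega>) powr q)"
proof (rule Bochner_Integration.integrable_bound)
  show "integrable M (\<lambda>\<omega>. 2 powr q * (norm (f \<omega>) powr q + norm (g \<omega>) powr q))"
    using int by simp
  show "AE \<omega> in M. norm (norm (f \<omega> + g \<omega>) powr q)
      \<le> norm (2 powr q * (norm (f \<omega>) powr q + norm (g \<omega>) powr q))"
  proof (rule AE_I2)
    fix \<omega>
    have "norm (f \<omega> + g \<omega>) powr q \<le> (norm (f \<omega>) + norm (g \<omega>)) powr q"
      using assms by (intro powr_mono2 norm_triangle_ineq) auto
    also have "\<dots> \<le> 2 powr q * (norm (f \<omega>) powr q + norm (g \<omega>) powr q)"
      using assms by (intro powr_add2_le) auto
    finally show "norm (norm (f \<omega> + g \<omega>) powr q)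
      \<le> norm (2 powr q * (norm (f \<omega>) powr q + norm (g \<omega>) powr q))" by simp
  qed
qed measurable

text \<open>The expectation of the scaled expansion for a deterministic error \<open>e\<close>, with
  \<open>S\<close> for \<open>e + V\<close> and \<open>R\<close> for the local error. The moments
  are assumed in the units \<open>sqrt h * d\<close> and \<open>sqrt h * norm e\<close> of the
  scaling, so the quotients in the remainder integrate to at most \<open>B2\<close> and
  \<open>B3\<close>.\<close>

lemma (in prob_space) moment_one_step:
  fixes R S :: "'a \<Rightarrow> 'b::euclidean_space" and e :: 'b
  assumes q: "2 \<le> q" and h: "0 < h" "h \<le> 1" and d: "0 < d"
    and meas: "S \<in> borel_measurable M"
    and R: "integrable M R" "norm (\<integral>\<omega>. R \<omega> \<partial>M) \<le> B1 * (h * d)"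
    and Rq: "integrable M (\<lambda>\<omega>. norm (R \<omega>) powr q)"
      "(\<integral>\<omega>. norm (R \<omega>) powr q \<partial>M) \<le> B2 * (sqrt h * d) powr q"
    and Sq: "integrable M (\<lambda>\<omega>. norm (S \<omega>) powr q)"
      "(\<integral>\<omega>. norm (S \<omega>) powr q \<partial>M) \<le> norm e powr q * (1 + \<kappa> * h)"
    and Vq: "integrable M (\<lambda>\<omega>. norm (S \<omega> - e) powr q)"
      "(\<integral>\<omega>. norm (S \<omega> - e) powr q \<partial>M) \<le> B3 * (sqrt h * norm e) powr q"
    and S0: "\<And>\<omega>. \<omega> \<in> space M \<Longrightarrow> e = 0 \<Longrightarrow> S \<omega> = 0"
    and B: "0 \<le> B1" "0 \<le> B3"
  shows "integrable M (\<lambda>\<omega>. norm (S \<omega> + R \<omega>) powr q)"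
    and "(\<integral>\<omega>. norm (S \<omega> + R \<omega>) powr q \<partial>M) \<le> norm e powr q * (1 + \<kappa> * h)
      + h * (d * (d + norm e) powr (q - 1) * (q * B1 + q * (q - 1) * 3 powr q * (1 + B2 + B3)))"
proof -
  note [measurable] = meas borel_measurable_integrable[OF R(1)]
  show int: "integrable M (\<lambda>\<omega>. norm (S \<omega> + R \<omega>) powr q)"
    using q Sq(1) Rq(1) by (intro integrable_norm_powr_add) auto
  let ?u = "norm e"
  define C where "C = q * (q - 1) * 3 powr q * h * d * (d + ?u) powr (q - 1)"
  have C: "0 \<le> C" using q h d by (simp add: C_def)
  let ?bound = "\<lambda>\<omega>. norm (S \<omega>) powr q + q * ?u powr (q - 2) * (e \<bullet> R \<omega>)
     + C * (1 + norm (R \<omega>) powr q / (sqrt h * d) powr q + norm (S \<omega> - e) powr q / (sqrt h * ?u) powr q)"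
  have "(\<integral>\<omega>. norm (S \<omega> + R \<omega>) powr q \<partial>M) \<le> (\<integral>\<omega>. ?bound \<omega> \<partial>M)"
  proof (rule integral_mono[OF int])
    show "integrable M ?bound"
      using Sq(1) R(1) Rq(1) Vq(1) by (auto intro!: Bochner_Integration.integrable_add integrable_mult_right)
    fix \<omega> assume \<omega>: "\<omega> \<in> space M"
    show "norm (S \<omega> + R \<omega>) powr q \<le> ?bound \<omega>"
      using norm_powr_expansion_scaled[OF q h d, of e "S \<omega> - e" "R \<omega>"] S0[OF \<omega>]
      by (simp add: C_def)
  qed
  also have "\<dots> = (\<integral>\<omega>. norm (S \<omega>) powr q \<partial>M) + q * ?u powr (q - 2) * (e \<bullet> (\<integral>\<omega>. R \<omega> \<partial>M))
     + C * (1 + (\<integral>\<omega>. norm (R \<omega>) powr q \<partial>M) / (sqrt h * d) powr q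
        + (\<integral>\<omega>. norm (S \<omega> - e) powr q \<partial>M) / (sqrt h * ?u) powr q)"
    using Sq(1) R(1) Rq(1) Vq(1) by (simp add: prob_space)
  also have "\<dots> \<le> ?u powr q * (1 + \<kappa> * h) + q * B1 * (h * (d * (d + ?u) powr (q - 1)))
     + C * (1 + B2 + B3)"
  proof (intro add_mono mult_left_mono Sq(2) C order_refl)
    \<comment> \<open>The linear term sees the mean of \<open>R\<close>, of order
      \<open>h * d\<close>, and not its typical size \<open>sqrt h * d\<close>. The gained factor
      \<open>sqrt h\<close> keeps the accumulated error bounded over order \<open>1/h\<close>
      steps.\<close>
    have "e \<bullet> (\<integral>\<omega>. R \<omega> \<partial>M) \<le> ?u * (B1 * (h * d))"
      using norm_cauchy_schwarz[of e "\<integral>\<omega>. R \<omega> \<partial>M"] mult_left_mono[OF R(2) norm_ge_zero[of e]] by linarith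
    then have "q * ?u powr (q - 2) * (e \<bullet> (\<integral>\<omega>. R \<omega> \<partial>M)) \<le> q * ?u powr (q - 2) * (?u * (B1 * (h * d)))"
      using q by (intro mult_left_mono) auto
    also have "\<dots> = q * B1 * (h * (d * (?u powr (q - 2) * ?u powr 1)))"
      by simp
    also have "?u powr (q - 2) * ?u powr 1 = ?u powr (q - 1)"
      using powr_add[of ?u "q - 2" 1] by simp
    also have "q * B1 * (h * (d * ?u powr (q - 1))) \<le> q * B1 * (h * (d * (d + ?u) powr (q - 1)))"
      using q B h d by (intro mult_left_mono powr_mono2) auto
    finally show "q * ?u powr (q - 2) * (e \<bullet> (\<integral>\<omega>. R \<omega> \<partial>M)) \<le> q * B1 * (h * (d * (d + ?u) powr (q - 1)))" .
    show "(\<integral>\<omega>. norm (R \<omega>) powr q \<partial>M) / (sqrt h * d) powr q \<le> B2"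
      using Rq(2) h d by (simp add: divide_le_eq)
    \<comment> \<open>For \<open>e = 0\<close> the divisor is \<open>0\<close>, so the quotient is
      \<open>0\<close> and \<open>0 \<le> B3\<close> closes the case.\<close>
    show "(\<integral>\<omega>. norm (S \<omega> - e) powr q \<partial>M) / (sqrt h * ?u) powr q \<le> B3"
      using Vq(2) h B by (cases "e = 0") (auto simp: divide_le_eq)
  qed
  finally show "(\<integral>\<omega>. norm (S \<omega> + R \<omega>) powr q \<partial>M) \<le> ?u powr q * (1 + \<kappa> * h)
      + h * (d * (d + ?u) powr (q - 1) * (q * B1 + q * (q - 1) * 3 powr q * (1 + B2 + B3)))"
    by (simp add: C_def algebra_simps)
qed

lemma powr_le_one_plus_powr:
  fixes a b z :: real
  assumes "0 \<le> a" "a \<le> b" "0 \<le> z"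
  shows "z powr a \<le> 1 + z powr b"
proof (cases "z \<le> 1")
  case True
  then have "z powr a \<le> 1" using assms by (simp add: powr_le1)
  then show ?thesis by (simp add: add_increasing2)
next
  case False
  then have "z powr a \<le> z powr b" using assms by (intro powr_mono) auto
  then show ?thesis by simp
qed

text \<open>This feeds (A1) and (A3) into \<open>moment_one_step\<close>. Here \<open>f\<close> and
  \<open>g\<close> are the two mappings started at \<open>x\<close>, and \<open>g'\<close> is the
  second mapping started at \<open>y\<close>, so \<open>f - g'\<close> is the propagated error
  \<open>g - g'\<close> plus the local error \<open>f - g\<close>.\<close>

lemma (in prob_space) moment_local_error:
  fixes f g g' V :: "'a \<Rightarrow> real ^ 'd::finite" and x y :: "real ^ 'd"
  assumes p: "1 \<le> p" "1/2 \<le> p2" "p2 + 1/2 \<le> p1" "1 \<le> \<alpha>" "1 \<le> \<beta>" "0 < K1"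
    and h: "0 < h" "h \<le> 1"
    and [measurable]: "g \<in> borel_measurable M" "g' \<in> borel_measurable M"
    and mean: "integrable M (\<lambda>\<omega>. f \<omega> - g \<omega>)"
      "norm (\<integral>\<omega>. f \<omega> - g \<omega> \<partial>M) \<le> K1 * (1 + norm x powr (2 * \<alpha>)) powr (1/2) * h powr p1"
    and mom: "finite_moment M (2 * p) (\<lambda>\<omega>. f \<omega> - g \<omega>)"
      "(moment M (2 * p) (\<lambda>\<omega>. f \<omega> - g \<omega>)) powr (1 / (2 * p))
        \<le> K1 * (1 + norm x powr (2 * \<alpha> * p)) powr (1 / (2 * p)) * h powr p2"
    and diff: "\<And>\<omega>. \<omega> \<in> space M \<Longrightarrow> g \<omega> - g' \<omega> = x - y + V \<omega>"
      "\<And>\<omega>. \<omega> \<in> space M \<Longrightarrow> x = y \<Longrightarrow> g \<omega> = g' \<omega>"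
    and S: "finite_moment M (2 * p) (\<lambda>\<omega>. g \<omega> - g' \<omega>)"
      "moment M (2 * p) (\<lambda>\<omega>. g \<omega> - g' \<omega>) \<le> norm (x - y) powr (2 * p) * (1 + K3 * h)"
    and V: "finite_moment M (2 * p) V"
      "moment M (2 * p) V
        \<le> K3 * (1 + norm x powr (p * \<beta>) + norm y powr (p * \<beta>)) * norm (x - y) powr (2 * p) * h powr p"
    and q: "q = 2 * p" and m: "m = max (2 * \<alpha> * p) (p * \<beta>)"
    and d: "d = h powr (p2 - 1/2)"
    and c: "c = q * (2 * K1) + q * (q - 1) * 3 powr q * (1 + 2 * K1 powr q + 3 * \<bar>K3\<bar>)"
  shows "integrable M (\<lambda>\<omega>. norm (f \<omega> - g' \<omega>) powr q)"
    and "(\<integral>\<omega>. norm (f \<omega> - g' \<omega>) powr q \<partial>M) \<le> norm (x - y) powr q * (1 + (\<bar>K3\<bar> + 2 powr q) * h)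
      + h * d powr q * (2 powr q + (3 * c) powr q * (1 + norm x powr (m * q) + norm y powr (m * q)))"
proof -
  have q2: "2 \<le> q" and d0: "0 < d" using p h by (auto simp: q d)
  \<comment> \<open>One weight dominates all polynomial growth factors of (A1) and (A3), because
    \<open>m\<close> is at least each of their exponents.\<close>
  define \<Gamma> where "\<Gamma> = 1 + norm x powr m + norm y powr m"
  have \<Gamma>1: "1 \<le> \<Gamma>" by (simp add: \<Gamma>_def)
  have x_le: "norm x powr a \<le> \<Gamma>" and y_le: "norm y powr a \<le> \<Gamma>" if "0 \<le> a" "a \<le> m" for a
    using powr_le_one_plus_powr[OF that norm_ge_zero[of x]] powr_le_one_plus_powr[OF that norm_ge_zero[of y]]
      powr_ge_zero[of "norm x" m] powr_ge_zero[of "norm y" m]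
    unfolding \<Gamma>_def by linarith+
  have m_ge: "2 * \<alpha> * p \<le> m" "p * \<beta> \<le> m" by (auto simp: m)
  have "2 * \<alpha> \<le> 2 * \<alpha> * p" using mult_left_mono[of 1 p "2 * \<alpha>"] p by simp
  with m_ge have "2 * \<alpha> \<le> m" by linarith
  have sqrt_h: "sqrt h = h powr (1/2)" using h by (simp add: powr_half_sqrt)
  \<comment> \<open>The unit \<open>d\<close> is chosen so that \<open>sqrt h * d\<close> is the
    order \<open>h powr p2\<close> of the local error in the \<open>q\<close>-th mean. Then
    \<open>h * d\<close> has the exponent \<open>p2 + 1/2\<close>, the smallest one allowed for the
    mean of the local error.\<close>
  have hd: "h * d = h powr (p2 + 1/2)"
  proof -
    have "p2 + 1/2 = 1 + (p2 - 1/2)" by simp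
    then show ?thesis using h by (simp only: powr_add d) simp
  qed
  have shd: "(sqrt h * d) powr q = (h powr p2) powr q"
    unfolding sqrt_h d powr_add[symmetric] by simp
  have shu: "(sqrt h * norm (x - y)) powr q = norm (x - y) powr q * h powr p"
    unfolding sqrt_h q using h by (simp add: powr_mult powr_powr)
  have 1: "norm (\<integral>\<omega>. f \<omega> - g \<omega> \<partial>M) \<le> (2 * K1 * \<Gamma>) * (h * d)"
  proof -
    let ?z = "1 + norm x powr (2 * \<alpha>)"
    have "?z powr (1/2) \<le> ?z powr 1" by (intro powr_mono) auto
    also have "\<dots> \<le> 2 * \<Gamma>"
      using x_le[of "2 * \<alpha>"] \<open>2 * \<alpha> \<le> m\<close> p \<Gamma>1 by simp
    finally have "?z powr (1/2) \<le> 2 * \<Gamma>" .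
    moreover have "h powr p1 \<le> h * d"
      unfolding hd using p h by (intro powr_mono') auto
    ultimately have "K1 * ?z powr (1/2) * h powr p1 \<le> K1 * (2 * \<Gamma>) * (h * d)"
      using p \<Gamma>1 by (intro mult_mono mult_left_mono) auto
    with mean(2) show ?thesis by (simp add: mult_ac)
  qed
  have 2: "(\<integral>\<omega>. norm (f \<omega> - g \<omega>) powr q \<partial>M) \<le> (2 * K1 powr q * \<Gamma>) * (sqrt h * d) powr q"
  proof -
    let ?I = "\<integral>\<omega>. norm (f \<omega> - g \<omega>) powr q \<partial>M" and ?z = "1 + norm x powr (2 * \<alpha> * p)"
    have "0 \<le> ?I" by simp
    then have "?I = (?I powr (1 / q)) powr q" using q2 by (simp add: powr_powr)
    also have "\<dots> \<le> (K1 * ?z powr (1 / q) * h powr p2) powr q"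
      using mom(2) q2 by (intro powr_mono2) (auto simp: moment_def q)
    also have "\<dots> = K1 powr q * ?z * (h powr p2) powr q"
      using p q2 by (simp add: powr_mult powr_powr add_pos_nonneg)
    also have "\<dots> \<le> K1 powr q * (2 * \<Gamma>) * (h powr p2) powr q"
      using x_le[of "2 * \<alpha> * p"] m_ge p \<Gamma>1 by (intro mult_right_mono mult_left_mono) auto
    finally show ?thesis unfolding shd by (simp add: mult_ac)
  qed
  \<comment> \<open>No sign of \<open>K3\<close> is assumed; the absolute value keeps the
    coefficients nonnegative, here and in the bound for \<open>V\<close>.\<close>
  have 3: "(\<integral>\<omega>. norm (g \<omega> - g' \<omega>) powr q \<partial>M) \<le> norm (x - y) powr q * (1 + \<bar>K3\<bar> * h)"
    using S(2) h mult_left_mono[of "1 + K3 * h" "1 + \<bar>K3\<bar> * h" "norm (x - y) powr q"]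
    by (auto simp: moment_def q mult_right_mono)
  have V_eq: "norm (V \<omega>) powr q = norm (g \<omega> - g' \<omega> - (x - y)) powr q" if "\<omega> \<in> space M" for \<omega>
    using diff(1)[OF that] by simp
  have 4: "integrable M (\<lambda>\<omega>. norm (g \<omega> - g' \<omega> - (x - y)) powr q)"
    using V(1) unfolding finite_moment_def q[symmetric]
    by (subst Bochner_Integration.integrable_cong[OF refl V_eq[symmetric]])
  have 5: "(\<integral>\<omega>. norm (g \<omega> - g' \<omega> - (x - y)) powr q \<partial>M) \<le> (3 * \<bar>K3\<bar> * \<Gamma>) * (sqrt h * norm (x - y)) powr q"
  proof -
    have "(\<integral>\<omega>. norm (g \<omega> - g' \<omega> - (x - y)) powr q \<partial>M) = moment M (2 * p) V"
      unfolding moment_def q[symmetric] by (rule Bochner_Integration.integral_cong[OF refl V_eq[symmetric]])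
    also have "\<dots> \<le> K3 * (1 + norm x powr (p * \<beta>) + norm y powr (p * \<beta>)) * norm (x - y) powr q * h powr p"
      using V(2) by (simp add: q)
    also have "\<dots> \<le> \<bar>K3\<bar> * (3 * \<Gamma>) * norm (x - y) powr q * h powr p"
      using x_le[of "p * \<beta>"] y_le[of "p * \<beta>"] m_ge p \<Gamma>1
      by (intro mult_right_mono mult_mono) auto
    finally show ?thesis by (simp add: shu mult_ac)
  qed
  note step = moment_one_step[OF q2 h d0 _ mean(1) 1 mom(1)[unfolded finite_moment_def q[symmetric]] 2
      S(1)[unfolded finite_moment_def q[symmetric]] 3 4 5]
  have fg: "g \<omega> - g' \<omega> + (f \<omega> - g \<omega>) = f \<omega> - g' \<omega>" for \<omega> by simp
  show "integrable M (\<lambda>\<omega>. norm (f \<omega> - g' \<omega>) powr q)"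
    using step(1) diff(2) p \<Gamma>1 by (simp add: fg)
  let ?u = "norm (x - y)"
  let ?G = "q * (2 * K1 * \<Gamma>) + q * (q - 1) * 3 powr q * (1 + 2 * K1 powr q * \<Gamma> + 3 * \<bar>K3\<bar> * \<Gamma>)"
  have c0: "0 \<le> c" unfolding c using p q2 by (intro add_nonneg_nonneg mult_nonneg_nonneg) auto
  \<comment> \<open>Since \<open>1 \<le> \<Gamma>\<close>, the weight factors out of all terms, and
    \<open>c\<close> is what remains.\<close>
  have "?G \<le> q * (2 * K1 * \<Gamma>) + q * (q - 1) * 3 powr q * (\<Gamma> + 2 * K1 powr q * \<Gamma> + 3 * \<bar>K3\<bar> * \<Gamma>)"
    using q2 \<Gamma>1 by (intro add_left_mono mult_left_mono) auto
  also have "\<dots> = c * \<Gamma>" unfolding c by (simp add: algebra_simps)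
  finally have G: "?G \<le> c * \<Gamma>" .
  have "(\<integral>\<omega>. norm (f \<omega> - g' \<omega>) powr q \<partial>M) \<le> ?u powr q * (1 + \<bar>K3\<bar> * h)
      + h * (d * (d + ?u) powr (q - 1) * ?G)"
    using step(2) diff(2) p \<Gamma>1 by (simp add: fg)
  also have "\<dots> \<le> ?u powr q * (1 + \<bar>K3\<bar> * h) + h * (2 powr q * (d powr q + ?u powr q)
      + d powr q * ((3 * c) powr q * (1 + norm x powr (m * q) + norm y powr (m * q))))"
  proof (intro add_left_mono mult_left_mono)
    \<comment> \<open>Young's inequality separates the error from the weight:
      \<open>(d + ?u) powr q\<close> returns the \<open>q\<close>-th power of the error with a
      constant factor, and the weight is left multiplied by \<open>d powr q\<close> alone, so that
      (A2) can integrate it.\<close>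
    have "d * (d + ?u) powr (q - 1) * ?G \<le> d * (d + ?u) powr (q - 1) * (c * \<Gamma>)"
      using d0 by (intro mult_left_mono G) auto
    also have "\<dots> = (d + ?u) powr (q - 1) * (d * (c * \<Gamma>))" by simp
    also have "\<dots> \<le> (d + ?u) powr q + (d * (c * \<Gamma>)) powr q"
      using q2 d0 c0 \<Gamma>1 by (intro mult_powr_le) auto
    also have "\<dots> \<le> 2 powr q * (d powr q + ?u powr q)
      + d powr q * ((3 * c) powr q * (1 + norm x powr (m * q) + norm y powr (m * q)))"
    proof (intro add_mono)
      show "(d + ?u) powr q \<le> 2 powr q * (d powr q + ?u powr q)"
        using q2 d0 by (intro powr_add2_le) auto
      have "\<Gamma> powr q \<le> 3 powr q * (1 + norm x powr (m * q) + norm y powr (m * q))"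
        using powr_add3_le[of q 1 "norm x powr m" "norm y powr m"] q2 by (simp add: \<Gamma>_def powr_powr)
      then have "d powr q * (c powr q * \<Gamma> powr q)
          \<le> d powr q * (c powr q * (3 powr q * (1 + norm x powr (m * q) + norm y powr (m * q))))"
        by (intro mult_left_mono) auto
      then show "(d * (c * \<Gamma>)) powr q
          \<le> d powr q * ((3 * c) powr q * (1 + norm x powr (m * q) + norm y powr (m * q)))"
        using d0 c0 \<Gamma>1 by (simp add: powr_mult mult_ac)
    qed
    finally show "d * (d + ?u) powr (q - 1) * ?G \<le> 2 powr q * (d powr q + ?u powr q)
      + d powr q * ((3 * c) powr q * (1 + norm x powr (m * q) + norm y powr (m * q)))" .
  qed (use h in auto)
  finally show "(\<integral>\<omega>. norm (f \<omega> - g' \<omega>) powr q \<partial>M) \<le> ?u powr q * (1 + (\<bar>K3\<bar> + 2 powr q) * h)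
      + h * d powr q * (2 powr q + (3 * c) powr q * (1 + norm x powr (m * q) + norm y powr (m * q)))"
    by (simp add: algebra_simps)
qed

section \<open>Independence of the driving path from the past\<close>

text \<open>
  Only single increments are assumed to be independent of the past. The induction splits off the
  increment after the largest time: it is independent of a \<open>\<sigma>\<close>-algebra of the filtration that
  contains the past and all earlier increments.
\<close>
lemma (in prob_space) indep_set_increments:
  fixes W :: "real \<Rightarrow> 'a \<Rightarrow> 'b::euclidean_space"
  assumes filt: "filtration (space M) F" and sub: "\<And>t. subalgebra M (F t)"
    and adapted: "\<And>t. 0 \<le> t \<Longrightarrow> W t \<in> borel_measurable (F t)"
    and indep: "\<And>s t. 0 \<le> s \<Longrightarrow> s < t \<Longrightarrow>
        indep_set (sets (F s)) (sets (vimage_algebra (space M) (\<lambda>\<omega>. W t \<omega> - W s \<omega>) borel))"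
    and s: "0 \<le> s" and J: "finite J" "J \<subseteq> {s<..}"
  shows "indep_set (sets (F s))
    (sigma_sets (space M) {(\<lambda>\<omega>. W r \<omega> - W s \<omega>) -` C \<inter> space M |r C. r \<in> J \<and> C \<in> sets borel})"
  using J
proof (induction J rule: finite_linorder_max_induct)
  case empty
  have "sets (F s) \<subseteq> events" using sub[of s] by (simp add: subalgebra_def)
  then show ?case
    by (intro indep_setI) (auto simp: sigma_sets_empty_eq prob_space Int_absorb2 dest: sets.sets_into_space)
next
  case (insert b A)
  interpret filtration "space M" F by fact
  let ?\<Omega> = "space M"
  let ?gen = "\<lambda>A. {(\<lambda>\<omega>. W r \<omega> - W s \<omega>) -` C \<inter> ?\<Omega> |r C. r \<in> A \<and> C \<in> sets borel}"
  have gen: "?gen A \<subseteq> Pow ?\<Omega>" for A by auto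
  \<comment> \<open>The last time before \<open>b\<close>; it is \<open>s\<close> itself when
    \<open>A\<close> is empty.\<close>
  define s' where "s' = Max (insert s A)"
  have s': "s \<le> s'" "s' < b" "\<And>r. r \<in> A \<Longrightarrow> r \<le> s'" "s' \<in> insert s A" "0 \<le> s'"
    using insert.hyps insert.prems s Max_in[of "insert s A"] Max_ge[of "insert s A" s]
    by (auto simp: s'_def intro: order_trans)
  define H where "H = sigma_sets ?\<Omega> (?gen A)"
  define D where "D = sets (vimage_algebra ?\<Omega> (\<lambda>\<omega>. W b \<omega> - W s' \<omega>) borel)"
  \<comment> \<open>An intersection-stable generator of the join of \<open>H\<close>, the earlier
    increments, and \<open>D\<close>, the last one.\<close>
  define P where "P = {a \<inter> c |a c. a \<in> H \<and> c \<in> D}"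
  have "?gen A \<subseteq> sets (F s')"
  proof clarsimp
    fix r and C :: "'b set" assume r: "r \<in> A" and C: "C \<in> sets borel"
    have "W r \<in> borel_measurable (F s')" "W s \<in> borel_measurable (F s')"
      using adapted[of r] adapted[of s] sets_F_mono[of r s'] sets_F_mono[of s s'] s' r s insert.prems
      by (force simp: measurable_def space_F)+
    then have "(\<lambda>\<omega>. W r \<omega> - W s \<omega>) \<in> borel_measurable (F s')" by measurable
    from measurable_sets[OF this C] show "(\<lambda>\<omega>. W r \<omega> - W s \<omega>) -` C \<inter> ?\<Omega> \<in> sets (F s')"
      by (simp add: space_F)
  qed
  then have HF: "H \<subseteq> sets (F s')"
    using sets.sigma_sets_subset[of "?gen A" "F s'"] by (simp add: H_def space_F)
  have FH: "indep_set (sets (F s)) H" unfolding H_def using insert by auto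
  have FD: "indep_set (sets (F s')) D" unfolding D_def using indep s' by auto
  have ev: "sets (F s) \<subseteq> events" "H \<subseteq> events" "D \<subseteq> events"
    using indep_setD_ev1[OF FH] indep_setD_ev2[OF FH] indep_setD_ev2[OF FD] by auto
  have FsF: "sets (F s) \<subseteq> sets (F s')" using sets_F_mono s' by auto
  have P_ev: "P \<subseteq> events" using ev by (auto simp: P_def)
  \<comment> \<open>As \<open>f\<close> and \<open>a\<close> are events of \<open>F s'\<close>, the
    event \<open>c\<close> splits off from \<open>f \<inter> a\<close> and also from
    \<open>a\<close>. The induction hypothesis separates \<open>f\<close> from
    \<open>a\<close>.\<close>
  have "indep_set (sets (F s)) P"
  proof (rule indep_setI)
    fix f g assume f: "f \<in> sets (F s)" and "g \<in> P"
    then obtain a c where g: "g = a \<inter> c" "a \<in> H" "c \<in> D" by (auto simp: P_def)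
    have "prob (f \<inter> g) = prob ((f \<inter> a) \<inter> c)" by (simp add: g Int_assoc)
    also have "\<dots> = prob (f \<inter> a) * prob c"
      using FsF HF f g by (intro indep_setD[OF FD]) auto
    also have "\<dots> = prob f * prob a * prob c"
      using f g by (simp add: indep_setD[OF FH])
    also have "\<dots> = prob f * prob (a \<inter> c)"
      using HF g by (subst indep_setD[OF FD]) auto
    finally show "prob (f \<inter> g) = prob f * prob g" by (simp add: g)
  qed (use ev P_ev in auto)
  moreover have "Int_stable P"
  proof (rule Int_stableI)
    fix x y assume "x \<in> P" "y \<in> P"
    then obtain a c a' c' where xy: "x = a \<inter> c" "y = a' \<inter> c'" "a \<in> H" "c \<in> D" "a' \<in> H" "c' \<in> D"
      by (auto simp: P_def)
    have "a \<inter> a' \<in> sets (sigma ?\<Omega> (?gen A))"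
      using xy gen by (intro sets.Int) (auto simp: H_def)
    then have "a \<inter> a' \<in> H" using gen[of A] by (simp add: H_def)
    moreover have "c \<inter> c' \<in> D" using xy by (auto simp: D_def)
    moreover have "x \<inter> y = (a \<inter> a') \<inter> (c \<inter> c')" using xy by auto
    ultimately show "x \<inter> y \<in> P" by (auto simp: P_def)
  qed
  ultimately have ind: "indep_set (sets (F s)) (sigma_sets ?\<Omega> P)"
    using indep_set_sigma_sets[of "sets (F s)" P] sets.Int_stable[of "F s"]
      sets.sigma_sets_eq[of "F s"] by (simp add: space_F)
  let ?N = "sigma ?\<Omega> P"
  have P: "P \<subseteq> Pow ?\<Omega>" using P_ev sets.space_closed[of M] by (rule order_trans)
  have top: "?\<Omega> \<in> H" "?\<Omega> \<in> D"
    unfolding H_def D_def using sets.top[of "vimage_algebra ?\<Omega> (\<lambda>\<omega>. W b \<omega> - W s' \<omega>) borel"]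
    by (auto intro: sigma_sets_top)
  have HP: "H \<subseteq> P"
  proof
    fix a assume a: "a \<in> H"
    then have "a \<inter> ?\<Omega> = a" using ev sets.sets_into_space[of a M] by blast
    with a top show "a \<in> P" unfolding P_def by blast
  qed
  have DP: "D \<subseteq> P"
  proof
    fix c assume c: "c \<in> D"
    then have "?\<Omega> \<inter> c = c" using ev sets.sets_into_space[of c M] by blast
    with c top show "c \<in> P" unfolding P_def by blast
  qed
  have meas_A: "(\<lambda>\<omega>. W r \<omega> - W s \<omega>) \<in> borel_measurable ?N" if "r \<in> insert s A" for r
  proof (cases "r = s")
    case False
    show ?thesis
    proof (rule measurableI)
      fix C :: "'b set" assume "C \<in> sets borel"
      then have "(\<lambda>\<omega>. W r \<omega> - W s \<omega>) -` C \<inter> ?\<Omega> \<in> H"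
        using that False unfolding H_def by (intro sigma_sets.Basic) blast
      then show "(\<lambda>\<omega>. W r \<omega> - W s \<omega>) -` C \<inter> space ?N \<in> sets ?N"
        using HP P by (auto simp: space_measure_of_conv)
    qed simp
  qed simp
  have meas_D: "(\<lambda>\<omega>. W b \<omega> - W s' \<omega>) \<in> borel_measurable ?N"
  proof (rule measurableI)
    fix C :: "'b set" assume "C \<in> sets borel"
    then have "(\<lambda>\<omega>. W b \<omega> - W s' \<omega>) -` C \<inter> ?\<Omega> \<in> D"
      unfolding D_def by (rule in_vimage_algebra)
    then show "(\<lambda>\<omega>. W b \<omega> - W s' \<omega>) -` C \<inter> space ?N \<in> sets ?N"
      using DP P by (auto simp: space_measure_of_conv)
  qed simp
  \<comment> \<open>The increment from \<open>s\<close> to \<open>b\<close> is recovered from the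
    last increment and the one up to \<open>s'\<close>. The latter vanishes if
    \<open>s' = s\<close>, which is why \<open>meas_A\<close> covers \<open>s\<close> as
    well.\<close>
  have "(\<lambda>\<omega>. (W b \<omega> - W s' \<omega>) + (W s' \<omega> - W s \<omega>)) \<in> borel_measurable ?N"
    using meas_D meas_A[OF s'(4)] by (rule borel_measurable_add)
  then have meas_b: "(\<lambda>\<omega>. W b \<omega> - W s \<omega>) \<in> borel_measurable ?N" by simp
  have "?gen (insert b A) \<subseteq> sets ?N"
  proof clarify
    fix r and C :: "'b set" assume r: "r \<in> insert b A" and C: "C \<in> sets borel"
    have "(\<lambda>\<omega>. W r \<omega> - W s \<omega>) \<in> borel_measurable ?N"
      using r meas_A meas_b by auto
    from measurable_sets[OF this C] show "(\<lambda>\<omega>. W r \<omega> - W s \<omega>) -` C \<inter> ?\<Omega> \<in> sets ?N"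
      by (simp add: space_measure_of_conv)
  qed
  then have "sigma_sets ?\<Omega> (?gen (insert b A)) \<subseteq> sigma_sets ?\<Omega> P"
    using sets.sigma_sets_subset[of _ ?N] P by (simp add: space_measure_of_conv)
  with ind show ?case by (auto simp: indep_sets2_eq)
qed

text \<open>The measure \<open>N\<close> is arbitrary because the path has to be measurable for the
  whole space, for the filtration at the end of a step, and for the \<open>\<sigma>\<close>-algebra
  of the future increments.\<close>

lemma measurable_increment_path:
  fixes W :: "real \<Rightarrow> 'a \<Rightarrow> real ^ 'm::finite"
  assumes "0 \<le> t" "0 \<le> h" and cont: "\<And>\<omega>. \<omega> \<in> space N \<Longrightarrow> continuous_on {0..} (\<lambda>t. W t \<omega>)"
    and meas: "\<And>r. t < r \<Longrightarrow> r \<le> t + h \<Longrightarrow> (\<lambda>\<omega>. W r \<omega> - W t \<omega>) \<in> borel_measurable N"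
  shows "increment_path W t h \<in> N \<rightarrow>\<^sub>M path_space"
  unfolding path_space_def
proof (rule measurable_restrict_space2)
  have "continuous_on UNIV (increment_path W t h \<omega>)" if "\<omega> \<in> space N" for \<omega>
    unfolding increment_path_def using assms(1,2) cont[OF that]
    by (intro continuous_on_ext_cont continuous_intros) (auto elim: continuous_on_subset)
  then show "increment_path W t h \<in> space N \<rightarrow> {w. continuous_on UNIV w}" by auto
  show "increment_path W t h \<in> N \<rightarrow>\<^sub>M Pi\<^sub>M UNIV (\<lambda>s. borel)"
  proof (rule measurable_PiM_single')
    fix u :: real
    \<comment> \<open>Every coordinate of the continued path is an increment up to the clamped time.
      At the clamped time \<open>t\<close>, which \<open>meas\<close> does not cover, it is the
      constant \<open>0\<close>.\<close>
    have "clamp t (t + h) u \<in> cbox t (t + h)" using assms by (intro clamp_in_interval) auto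
    then have u: "t \<le> clamp t (t + h) u" "clamp t (t + h) u \<le> t + h" by auto
    have "(\<lambda>\<omega>. W (clamp t (t + h) u) \<omega> - W t \<omega>) \<in> borel_measurable N"
      using meas[of "clamp t (t + h) u"] u by (cases "clamp t (t + h) u = t") auto
    then show "(\<lambda>\<omega>. increment_path W t h \<omega> u) \<in> borel_measurable N"
      by (simp add: increment_path_def ext_cont_def)
  qed auto
qed

text \<open>The events that depend on finitely many increments after \<open>t\<close> form an
  intersection-stable family, since two finite sets of times lie in their union. Independence
  therefore extends to the \<open>\<sigma>\<close>-algebra they generate, and the path is measurable
  for it.\<close>

lemma (in prob_space) indep_set_increment_path:
  fixes W :: "real \<Rightarrow> 'a \<Rightarrow> real ^ 'm::finite"
  assumes filt: "filtration (space M) F" and sub: "\<And>t. subalgebra M (F t)"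
    and adapted: "\<And>t. 0 \<le> t \<Longrightarrow> W t \<in> borel_measurable (F t)"
    and indep: "\<And>s t. 0 \<le> s \<Longrightarrow> s < t \<Longrightarrow>
        indep_set (sets (F s)) (sets (vimage_algebra (space M) (\<lambda>\<omega>. W t \<omega> - W s \<omega>) borel))"
    and cont: "\<And>\<omega>. \<omega> \<in> space M \<Longrightarrow> continuous_on {0..} (\<lambda>t. W t \<omega>)"
    and t: "0 \<le> t" "0 \<le> h"
  shows "indep_set (sets (F t)) (sets (vimage_algebra (space M) (increment_path W t h) path_space))"
proof -
  let ?\<Omega> = "space M"
  let ?gen = "\<lambda>J. {(\<lambda>\<omega>. W r \<omega> - W t \<omega>) -` C \<inter> ?\<Omega> |r C. r \<in> J \<and> C \<in> sets borel}"
  define U where "U = (\<Union>J\<in>{J. finite J \<and> J \<subseteq> {t<..}}. sigma_sets ?\<Omega> (?gen J))"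
  have ind: "indep_set (sets (F t)) (sigma_sets ?\<Omega> (?gen J))" if "finite J" "J \<subseteq> {t<..}" for J
    using indep_set_increments[OF filt sub adapted indep t(1) that] by auto
  have space_F: "space (F t) = ?\<Omega>" and F_ev: "sets (F t) \<subseteq> events"
    using sub[of t] by (auto simp: subalgebra_def)
  have "indep_set (sets (F t)) U"
    using ind F_ev unfolding U_def indep_sets2_eq by blast
  moreover have "Int_stable U"
  proof (rule Int_stableI)
    fix a b assume "a \<in> U" "b \<in> U"
    then obtain J J' where J: "finite J" "J \<subseteq> {t<..}" "finite J'" "J' \<subseteq> {t<..}"
      "a \<in> sigma_sets ?\<Omega> (?gen J)" "b \<in> sigma_sets ?\<Omega> (?gen J')" by (auto simp: U_def)
    have g: "?gen (J \<union> J') \<subseteq> Pow ?\<Omega>" by auto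
    have "a \<in> sigma_sets ?\<Omega> (?gen (J \<union> J'))" "b \<in> sigma_sets ?\<Omega> (?gen (J \<union> J'))"
      using J(5,6) sigma_sets_mono'[of "?gen J" "?gen (J \<union> J')" ?\<Omega>]
        sigma_sets_mono'[of "?gen J'" "?gen (J \<union> J')" ?\<Omega>] by blast+
    then have "a \<inter> b \<in> sets (sigma ?\<Omega> (?gen (J \<union> J')))"
      using g by (intro sets.Int) auto
    then have "a \<inter> b \<in> sigma_sets ?\<Omega> (?gen (J \<union> J'))" using g by simp
    with J show "a \<inter> b \<in> U" unfolding U_def by (intro UN_I[of "J \<union> J'"]) auto
  qed
  ultimately have ind: "indep_set (sets (F t)) (sigma_sets ?\<Omega> U)"
    using indep_set_sigma_sets[of "sets (F t)" U] sets.Int_stable[of "F t"]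
      sets.sigma_sets_eq[of "F t"] by (simp add: space_F)
  have U: "U \<subseteq> Pow ?\<Omega>"
    using indep_setD_ev2[OF \<open>indep_set (sets (F t)) U\<close>] sets.space_closed[of M] by (rule order_trans)
  let ?N = "sigma ?\<Omega> U"
  have N: "space ?N = ?\<Omega>" "sets ?N = sigma_sets ?\<Omega> U" using U by (auto simp: space_measure_of_conv)
  have path: "increment_path W t h \<in> ?N \<rightarrow>\<^sub>M path_space"
  proof (rule measurable_increment_path[OF t])
    fix r assume "t < r"
    show "(\<lambda>\<omega>. W r \<omega> - W t \<omega>) \<in> borel_measurable ?N"
    proof (rule measurableI)
      fix C :: "(real ^ 'm) set" assume "C \<in> sets borel"
      then have "(\<lambda>\<omega>. W r \<omega> - W t \<omega>) -` C \<inter> ?\<Omega> \<in> sigma_sets ?\<Omega> (?gen {r})"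
        by (intro sigma_sets.Basic) blast
      then have "(\<lambda>\<omega>. W r \<omega> - W t \<omega>) -` C \<inter> ?\<Omega> \<in> U"
        unfolding U_def using \<open>t < r\<close> by (intro UN_I[of "{r}"]) auto
      then show "(\<lambda>\<omega>. W r \<omega> - W t \<omega>) -` C \<inter> space ?N \<in> sets ?N" by (auto simp: N)
    qed simp
  qed (use cont N in auto)
  have "sets (vimage_algebra ?\<Omega> (increment_path W t h) path_space) \<subseteq> sets ?N"
    using measurable_sets[OF path] measurable_space[OF path]
    by (subst sets_vimage_algebra2) (auto simp: N)
  with ind show ?thesis by (auto simp: indep_sets2_eq N)
qed

text \<open>The freezing lemma: by independence the joint law of \<open>X\<close> and
  \<open>Y\<close> is the product of their laws, which is checked on rectangles, and Tonelli gives
  the iterated integral. It lets bounds for deterministic starting points be applied at the random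
  values of the chains.\<close>

lemma (in prob_space) nn_integral_indep_set:
  assumes sub: "subalgebra M G" and X: "X \<in> G \<rightarrow>\<^sub>M S" and Y[measurable]: "Y \<in> M \<rightarrow>\<^sub>M T"
    and ind: "indep_set (sets G) (sets (vimage_algebra (space M) Y T))"
    and f[measurable]: "f \<in> borel_measurable (S \<Otimes>\<^sub>M T)"
  shows "(\<integral>\<^sup>+\<omega>. f (X \<omega>, Y \<omega>) \<partial>M) = (\<integral>\<^sup>+\<omega>. (\<integral>\<^sup>+\<omega>'. f (X \<omega>, Y \<omega>') \<partial>M) \<partial>M)"
proof -
  have [measurable]: "X \<in> M \<rightarrow>\<^sub>M S" by (rule measurable_from_subalg[OF sub X])
  interpret X: prob_space "distr M S X" by (rule prob_space_distr) fact
  interpret Y: prob_space "distr M T Y" by (rule prob_space_distr) fact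
  have eq: "distr M S X \<Otimes>\<^sub>M distr M T Y = distr M (S \<Otimes>\<^sub>M T) (\<lambda>x. (X x, Y x))"
  proof (rule pair_measure_eqI)
    fix A B assume "A \<in> sets (distr M S X)" "B \<in> sets (distr M T Y)"
    then have [measurable]: "A \<in> sets S" "B \<in> sets T" by auto
    have "X -` A \<inter> space M \<in> sets G"
      using measurable_sets[OF X, of A] sub by (simp add: subalgebra_def)
    then have "prob ((X -` A \<inter> space M) \<inter> (Y -` B \<inter> space M))
        = prob (X -` A \<inter> space M) * prob (Y -` B \<inter> space M)"
      by (intro indep_setD[OF ind] in_vimage_algebra) auto
    moreover have "(\<lambda>x. (X x, Y x)) -` (A \<times> B) \<inter> space M = (X -` A \<inter> space M) \<inter> (Y -` B \<inter> space M)"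
      by auto
    ultimately show "emeasure (distr M S X) A * emeasure (distr M T Y) B
        = emeasure (distr M (S \<Otimes>\<^sub>M T) (\<lambda>x. (X x, Y x))) (A \<times> B)"
      by (simp add: emeasure_distr emeasure_eq_measure ennreal_mult)
  qed (auto intro: X.sigma_finite_measure_axioms Y.sigma_finite_measure_axioms)
  have "(\<integral>\<^sup>+\<omega>. f (X \<omega>, Y \<omega>) \<partial>M) = (\<integral>\<^sup>+z. f z \<partial>distr M (S \<Otimes>\<^sub>M T) (\<lambda>x. (X x, Y x)))"
    by (subst nn_integral_distr) auto
  also have "\<dots> = (\<integral>\<^sup>+x. \<integral>\<^sup>+y. f (x, y) \<partial>distr M T Y \<partial>distr M S X)"
    unfolding eq[symmetric] by (rule Y.nn_integral_fst[symmetric]) simp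
  also have "\<dots> = (\<integral>\<^sup>+\<omega>. (\<integral>\<^sup>+y. f (X \<omega>, y) \<partial>distr M T Y) \<partial>M)"
    by (rule nn_integral_distr) measurable
  also have "\<dots> = (\<integral>\<^sup>+\<omega>. (\<integral>\<^sup>+\<omega>'. f (X \<omega>, Y \<omega>') \<partial>M) \<partial>M)"
  proof (rule nn_integral_cong)
    fix \<omega> assume "\<omega> \<in> space M"
    then have [measurable]: "X \<omega> \<in> space S" by (rule measurable_space[rotated]) fact
    show "(\<integral>\<^sup>+y. f (X \<omega>, y) \<partial>distr M T Y) = (\<integral>\<^sup>+\<omega>'. f (X \<omega>, Y \<omega>') \<partial>M)"
      by (rule nn_integral_distr) measurable
  qed
  finally show ?thesis .
qed

section \<open>Measurability of the mappings and adaptedness of the chains\<close>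

lemma measurable_increment_fun_compose:
  assumes A: "measurable_increment_fun A" and "x \<in> borel_measurable N" "w \<in> N \<rightarrow>\<^sub>M path_space"
  shows "(\<lambda>\<omega>. A t (x \<omega>) h (w \<omega>)) \<in> borel_measurable N"
proof -
  have "(\<lambda>\<omega>. (t, x \<omega>, h, w \<omega>)) \<in> N \<rightarrow>\<^sub>M borel \<Otimes>\<^sub>M borel \<Otimes>\<^sub>M borel \<Otimes>\<^sub>M path_space"
    using assms(2,3) by measurable
  from measurable_compose[OF this A[unfolded measurable_increment_fun_def]] show ?thesis by simp
qed

lemma measurable_one_step:
  assumes "measurable_increment_fun A" "x \<in> borel_measurable N"
    and "increment_path W t h \<in> N \<rightarrow>\<^sub>M path_space"
  shows "(\<lambda>\<omega>. one_step A W t (x \<omega>) h \<omega>) \<in> borel_measurable N"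
  unfolding one_step_def
  by (rule borel_measurable_add[OF assms(2) measurable_increment_fun_compose[OF assms]])

lemma measurable_chain:
  fixes W :: "real \<Rightarrow> 'a \<Rightarrow> real ^ 'm::finite"
  assumes "filtration \<Omega> F"
    and adapted: "\<And>t. 0 \<le> t \<Longrightarrow> W t \<in> borel_measurable (F t)"
    and cont: "\<And>\<omega>. \<omega> \<in> \<Omega> \<Longrightarrow> continuous_on {0..} (\<lambda>t. W t \<omega>)"
    and A: "measurable_increment_fun A" and "0 \<le> h" "0 \<le> t0" "X0 \<in> borel_measurable (F t0)"
  shows "chain A W t0 h X0 k \<in> borel_measurable (F (t0 + real k * h))"
proof (induction k)
  case 0
  then show ?case using assms by (simp add: measurable_def)
next
  case (Suc k)
  interpret filtration \<Omega> F by fact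
  have mono: "f \<in> borel_measurable (F t)" if "f \<in> borel_measurable (F s)" "s \<le> t"
    for s t and f :: "'a \<Rightarrow> real ^ 'n::finite"
    using that sets_F_mono[of s t] by (auto simp: measurable_def space_F)
  let ?s = "t0 + real k * h" and ?t = "t0 + real (Suc k) * h"
  have st: "0 \<le> ?s" "?s \<le> ?t" "?t = ?s + h" using assms by (auto simp: algebra_simps)
  have "increment_path W ?s h \<in> F ?t \<rightarrow>\<^sub>M path_space"
  proof (rule measurable_increment_path[OF st(1) \<open>0 \<le> h\<close>])
    fix r assume "?s < r" "r \<le> ?s + h"
    with st have "0 \<le> r" "r \<le> ?t" by linarith+
    with st have "W r \<in> borel_measurable (F ?t)" "W ?s \<in> borel_measurable (F ?t)"
      by (blast intro: mono adapted)+
    then show "(\<lambda>\<omega>. W r \<omega> - W ?s \<omega>) \<in> borel_measurable (F ?t)" by measurable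
  qed (use cont space_F in auto)
  from measurable_one_step[OF A mono[OF Suc st(2)] this] show ?case by simp
qed

section \<open>Convergence\<close>

text \<open>With equality the recursion started at \<open>0\<close> has the solution
  \<open>((1 + b) ^ k - 1) * c\<close>, which is the bound proved by induction. Because the
  inhomogeneity carries the factor \<open>b\<close>, no quotient by \<open>b\<close> appears, and
  the bound survives \<open>b = C * h\<close> with small \<open>h\<close>.\<close>

lemma discrete_gronwall:
  fixes a :: "nat \<Rightarrow> real"
  assumes "a 0 = 0" "0 \<le> b" "0 \<le> c"
    and step: "\<And>k. k < n \<Longrightarrow> a (Suc k) \<le> (1 + b) * a k + b * c"
    and "k \<le> n"
  shows "a k \<le> exp (b * real k) * c"
proof -
  have "a k \<le> ((1 + b) ^ k - 1) * c"
    using \<open>k \<le> n\<close>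
  proof (induction k)
    case (Suc k)
    have "a (Suc k) \<le> (1 + b) * a k + b * c" using step Suc.prems by simp
    also have "\<dots> \<le> (1 + b) * (((1 + b) ^ k - 1) * c) + b * c"
      using Suc assms by (intro add_right_mono mult_left_mono) auto
    finally show ?case by (simp add: algebra_simps)
  qed (use assms in simp)
  also have "\<dots> \<le> (1 + b) ^ k * c" using assms by (intro mult_right_mono) auto
  also have "(1 + b) ^ k \<le> exp b ^ k"
    using assms by (intro power_mono exp_ge_add_one_self) auto
  also have "exp b ^ k = exp (b * real k)" by (simp add: exp_of_nat2_mult)
  finally show ?thesis using assms(3) by (simp add: mult_right_mono)
qed

theorem theorem2p1:
  fixes M :: "'a measure"
    and F :: "real \<Rightarrow> 'a measure"
    and W :: "real \<Rightarrow> 'a \<Rightarrow> real ^ 'm"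
    and Abar Atilde :: "('d::finite, 'm::finite) increment_fun"
    and X0 :: "'a \<Rightarrow> real ^ 'd"
    and t0 T p p1 p2 \<alpha> \<beta> h0 K1 K3 :: real
  assumes "prob_space M" and "usual_conditions M F" and "standard_brownian_motion M F W"
    and "0 \<le> t0" and "t0 < T"
    and "measurable_increment_fun Abar" and "measurable_increment_fun Atilde"
    and "X0 \<in> borel_measurable (F t0)" and "finite_moment M 2 X0"
    and "p \<ge> 1" and "p2 \<ge> 1/2" and "p1 \<ge> p2 + 1/2" and "\<alpha> \<ge> 1" and "0 < h0" and "h0 \<le> 1"
    and "K1 > 0" and "\<beta> \<ge> 1"
    and A1_mean: "\<And>h t x. 0 < h \<Longrightarrow> h \<le> h0 \<Longrightarrow> t \<in> {t0..T - h} \<Longrightarrow>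
        integrable M (\<lambda>\<omega>. one_step Abar W t x h \<omega> - one_step Atilde W t x h \<omega>) \<and>
        norm (\<integral>\<omega>. one_step Abar W t x h \<omega> - one_step Atilde W t x h \<omega> \<partial>M)
          \<le> K1 * (1 + norm x powr (2 * \<alpha>)) powr (1/2) * h powr p1"
    and A1_moment: "\<And>h t x. 0 < h \<Longrightarrow> h \<le> h0 \<Longrightarrow> t \<in> {t0..T - h} \<Longrightarrow>
        finite_moment M (2 * p) (\<lambda>\<omega>. one_step Abar W t x h \<omega> - one_step Atilde W t x h \<omega>) \<and>
        (moment M (2 * p) (\<lambda>\<omega>. one_step Abar W t x h \<omega> - one_step Atilde W t x h \<omega>)) powr (1 / (2 * p))
          \<le> K1 * (1 + norm x powr (2 * \<alpha> * p)) powr (1 / (2 * p)) * h powr p2"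
    and A2: "\<And>q::real. q \<ge> 1 \<Longrightarrow> \<exists>K2>0. \<forall>N\<ge>1. \<forall>h. h = (T - t0) / real N \<and> h \<le> h0 \<longrightarrow>
        (\<forall>k\<le>N. finite_moment M q (chain Abar W t0 h X0 k) \<and>
                finite_moment M q (chain Atilde W t0 h X0 k) \<and>
                moment M q (chain Abar W t0 h X0 k) + moment M q (chain Atilde W t0 h X0 k) \<le> K2)"
    and A3: "\<And>h t x y. 0 < h \<Longrightarrow> h \<le> h0 \<Longrightarrow> t \<in> {t0..T - h} \<Longrightarrow>
        \<exists>V. (\<forall>\<omega>\<in>space M. one_step Atilde W t x h \<omega> - one_step Atilde W t y h \<omega> = x - y + V \<omega>) \<and>
            finite_moment M (2 * p) (\<lambda>\<omega>. one_step Atilde W t x h \<omega> - one_step Atilde W t y h \<omega>) \<and>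
            moment M (2 * p) (\<lambda>\<omega>. one_step Atilde W t x h \<omega> - one_step Atilde W t y h \<omega>)
              \<le> norm (x - y) powr (2 * p) * (1 + K3 * h) \<and>
            finite_moment M (2 * p) V \<and>
            moment M (2 * p) V
              \<le> K3 * (1 + norm x powr (p * \<beta>) + norm y powr (p * \<beta>)) * norm (x - y) powr (2 * p) * h powr p"
  shows "\<exists>K. \<forall>N\<ge>1. \<forall>h. h = (T - t0) / real N \<and> h \<le> h0 \<longrightarrow>
        (\<forall>k\<le>N. finite_moment M (2 * p) (\<lambda>\<omega>. chain Abar W t0 h X0 k \<omega> - chain Atilde W t0 h X0 k \<omega>) \<and>
                (moment M (2 * p) (\<lambda>\<omega>. chain Abar W t0 h X0 k \<omega> - chain Atilde W t0 h X0 k \<omega>)) powr (1 / (2 * p))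
                  \<le> K * h powr (p2 - 1/2))"
proof -
  interpret prob_space M by fact
  have filt: "filtration (space M) F" and sub: "\<And>t. subalgebra M (F t)"
    using \<open>usual_conditions M F\<close> by (auto simp: usual_conditions_def)
  have adapted: "\<And>t. 0 \<le> t \<Longrightarrow> W t \<in> borel_measurable (F t)"
    and cont: "\<And>\<omega>. \<omega> \<in> space M \<Longrightarrow> continuous_on {0..} (\<lambda>t. W t \<omega>)"
    and indep: "\<And>s t. 0 \<le> s \<Longrightarrow> s < t \<Longrightarrow>
        indep_set (sets (F s)) (sets (vimage_algebra (space M) (\<lambda>\<omega>. W t \<omega> - W s \<omega>) borel))"
    using \<open>standard_brownian_motion M F W\<close> by (auto simp: standard_brownian_motion_def)
  note Abar = \<open>measurable_increment_fun Abar\<close> and Atilde = \<open>measurable_increment_fun Atilde\<close>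
  define q where "q = 2 * p"
  define m where "m = max (2 * \<alpha> * p) (p * \<beta>)"
  define c where "c = q * (2 * K1) + q * (q - 1) * 3 powr q * (1 + 2 * K1 powr q + 3 * \<bar>K3\<bar>)"
  have q2: "2 \<le> q" using \<open>p \<ge> 1\<close> by (simp add: q_def)
  have "1 \<le> p * \<beta>" using mult_mono[of 1 p 1 \<beta>] \<open>p \<ge> 1\<close> \<open>\<beta> \<ge> 1\<close> by simp
  then have "1 \<le> m" by (simp add: m_def)
  \<comment> \<open>The exponent \<open>m * q\<close> is that of the weights in
    \<open>moment_local_error\<close>; (A2) bounds their expectations along both chains uniformly in
    \<open>h\<close> and \<open>k\<close>.\<close>
  then have "1 \<le> m * q" using mult_mono[of 1 m 1 q] q2 by simp
  then obtain K2 where "0 < K2" and K2: "\<And>N h k. 1 \<le> N \<Longrightarrow> h = (T - t0) / real N \<Longrightarrow> h \<le> h0 \<Longrightarrow> k \<le> N \<Longrightarrow>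
      finite_moment M (m * q) (chain Abar W t0 h X0 k) \<and>
      finite_moment M (m * q) (chain Atilde W t0 h X0 k) \<and>
      moment M (m * q) (chain Abar W t0 h X0 k) + moment M (m * q) (chain Atilde W t0 h X0 k) \<le> K2"
    using A2[of "m * q"] by metis
  \<comment> \<open>The part \<open>\<bar>K3\<bar> + 2 powr q\<close> is the growth rate of the
    error and the rest bounds the inhomogeneity. Their sum serves for both, which is the form that
    the Gronwall lemma takes.\<close>
  define C where "C = \<bar>K3\<bar> + 2 powr q + (2 powr q + (3 * c) powr q * (1 + K2))"
  have C0: "0 \<le> C" using \<open>0 < K2\<close> unfolding C_def by (intro add_nonneg_nonneg mult_nonneg_nonneg) auto
  define K where "K = exp (C * (T - t0)) powr (1 / q)"
  show ?thesis
  proof (intro exI[of _ K] allI impI, elim conjE)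
    fix N :: nat and h :: real and k :: nat
    assume N: "1 \<le> N" and h_eq: "h = (T - t0) / real N" and h_le: "h \<le> h0" and k: "k \<le> N"
    have h: "0 < h" "h \<le> 1" using h_eq N \<open>t0 < T\<close> h_le \<open>h0 \<le> 1\<close> by (simp, linarith)
    have Nh: "real N * h = T - t0" using h_eq N by simp
    define d where "d = h powr (p2 - 1/2)"
    let ?t = "\<lambda>k. t0 + real k * h"
    let ?X = "chain Abar W t0 h X0" and ?Y = "chain Atilde W t0 h X0"
    have t: "0 \<le> ?t k" for k using \<open>0 \<le> t0\<close> h by simp
    have XY: "?X k \<in> borel_measurable (F (?t k))" "?Y k \<in> borel_measurable (F (?t k))" for k
      using measurable_chain[OF filt adapted cont Abar _ \<open>0 \<le> t0\<close> \<open>X0 \<in> borel_measurable (F t0)\<close>]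
        measurable_chain[OF filt adapted cont Atilde _ \<open>0 \<le> t0\<close> \<open>X0 \<in> borel_measurable (F t0)\<close>] h by auto
    have XY_M [measurable]: "?X k \<in> borel_measurable M" "?Y k \<in> borel_measurable M" for k
      using measurable_from_subalg[OF sub] XY by blast+
    define a where "a = (\<lambda>k. \<integral>\<omega>. norm (?X k \<omega> - ?Y k \<omega>) powr q \<partial>M)"
    \<comment> \<open>Only finiteness is taken from (A2) here, so the bound for the exponent
      \<open>q\<close> does not enter \<open>K\<close>.\<close>
    have int: "integrable M (\<lambda>\<omega>. norm (?X k \<omega> - ?Y k \<omega>) powr q)" if "k \<le> N" for k
    proof -
      obtain K2' where "\<forall>N\<ge>1. \<forall>h. h = (T - t0) / real N \<and> h \<le> h0 \<longrightarrow>
        (\<forall>k\<le>N. finite_moment M q (chain Abar W t0 h X0 k) \<and> finite_moment M q (chain Atilde W t0 h X0 k) \<and>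
          moment M q (chain Abar W t0 h X0 k) + moment M q (chain Atilde W t0 h X0 k) \<le> K2')"
        using A2[of q] q2 by auto
      then have "finite_moment M q (?X k)" "finite_moment M q (?Y k)"
        using N h_eq h_le that by blast+
      then show ?thesis
        using q2 integrable_norm_powr_add[of q "?X k" M "\<lambda>\<omega>. - ?Y k \<omega>"]
        by (simp add: finite_moment_def)
    qed
    have step: "a (Suc k) \<le> (1 + C * h) * a k + C * h * d powr q" if "k < N" for k
    proof -
      \<comment> \<open>As \<open>k < N\<close>, the step from \<open>?t k\<close> ends at the next
        grid point, which is at most \<open>T\<close>.\<close>
      have tk: "?t k \<in> {t0..T - h}"
      proof -
        have "real (Suc k) * h \<le> real N * h" using that h by (intro mult_right_mono) auto
        then show ?thesis using Nh h by (simp add: algebra_simps)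
      qed
      let ?w = "increment_path W (?t k) h"
      have path: "?w \<in> M \<rightarrow>\<^sub>M path_space"
      proof (rule measurable_increment_path)
        fix r assume "?t k < r"
        then have [measurable]: "W r \<in> borel_measurable M" "W (?t k) \<in> borel_measurable M"
          using measurable_from_subalg[OF sub adapted] t[of k] by auto
        show "(\<lambda>\<omega>. W r \<omega> - W (?t k) \<omega>) \<in> borel_measurable M" by measurable
      qed (use t h cont in auto)
      let ?\<Phi> = "\<lambda>(z, w). ennreal (norm ((fst z + Abar (?t k) (fst z) h w) - (snd z + Atilde (?t k) (snd z) h w)) powr q)"
      let ?B = "\<lambda>x y. norm (x - y) powr q * (1 + (\<bar>K3\<bar> + 2 powr q) * h)
          + h * d powr q * (2 powr q + (3 * c) powr q * (1 + norm x powr (m * q) + norm y powr (m * q)))"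
      have one_step_meas: "one_step A W (?t k) x h \<in> borel_measurable M"
        if "measurable_increment_fun A" for A :: "('d, 'm) increment_fun" and x
        using measurable_one_step[OF that _ path, of "\<lambda>_. x"] by simp
      \<comment> \<open>With \<open>x\<close> and \<open>y\<close> fixed, the integrand is the
        \<open>q\<close>-th power of the error after one step from these points, so (A1) and (A3)
        apply directly.\<close>
      have inner: "(\<integral>\<^sup>+\<omega>. ?\<Phi> ((x, y), ?w \<omega>) \<partial>M) \<le> ennreal (?B x y)" for x y
      proof -
        let ?f = "one_step Abar W (?t k) x h" and ?g = "one_step Atilde W (?t k) x h"
          and ?g' = "one_step Atilde W (?t k) y h"
        from A3[OF h(1) h_le tk, of x y] obtain V where
          V: "\<forall>\<omega>\<in>space M. ?g \<omega> - ?g' \<omega> = x - y + V \<omega>"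
            "finite_moment M (2 * p) (\<lambda>\<omega>. ?g \<omega> - ?g' \<omega>)"
            "moment M (2 * p) (\<lambda>\<omega>. ?g \<omega> - ?g' \<omega>) \<le> norm (x - y) powr (2 * p) * (1 + K3 * h)"
            "finite_moment M (2 * p) V"
            "moment M (2 * p) V \<le> K3 * (1 + norm x powr (p * \<beta>) + norm y powr (p * \<beta>))
              * norm (x - y) powr (2 * p) * h powr p"
          by blast
        note bound = moment_local_error[OF \<open>p \<ge> 1\<close> \<open>p2 \<ge> 1/2\<close> \<open>p1 \<ge> p2 + 1/2\<close> \<open>\<alpha> \<ge> 1\<close> \<open>\<beta> \<ge> 1\<close> \<open>K1 > 0\<close> h
          one_step_meas[OF Atilde] one_step_meas[OF Atilde]
          conjunct1[OF A1_mean[OF h(1) h_le tk]] conjunct2[OF A1_mean[OF h(1) h_le tk]]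
          conjunct1[OF A1_moment[OF h(1) h_le tk]] conjunct2[OF A1_moment[OF h(1) h_le tk]]
          _ _ V(2-5) q_def m_def d_def c_def]
        have "integrable M (\<lambda>\<omega>. norm (?f \<omega> - ?g' \<omega>) powr q)"
          "(\<integral>\<omega>. norm (?f \<omega> - ?g' \<omega>) powr q \<partial>M) \<le> ?B x y"
          using V(1) by (auto intro!: bound)
        then have "(\<integral>\<^sup>+\<omega>. ennreal (norm (?f \<omega> - ?g' \<omega>) powr q) \<partial>M) \<le> ennreal (?B x y)"
          by (subst nn_integral_eq_integral) (auto intro: ennreal_leI)
        then show ?thesis by (simp add: one_step_def)
      qed
      have B_int: "integrable M (\<lambda>\<omega>. ?B (?X k \<omega>) (?Y k \<omega>))"
        using int[of k] K2[OF N h_eq h_le, of k] that unfolding finite_moment_def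
        by (intro Bochner_Integration.integrable_add integrable_mult_right integrable_mult_left integrable_const) auto
      have "ennreal (a (Suc k)) = (\<integral>\<^sup>+\<omega>. ennreal (norm (?X (Suc k) \<omega> - ?Y (Suc k) \<omega>) powr q) \<partial>M)"
        unfolding a_def using int[of "Suc k"] that by (subst nn_integral_eq_integral) auto
      also have "\<dots> = (\<integral>\<^sup>+\<omega>. ?\<Phi> ((?X k \<omega>, ?Y k \<omega>), ?w \<omega>) \<partial>M)"
        by (simp add: one_step_def)
      \<comment> \<open>The pair of chain values is measurable at time \<open>?t k\<close> and the
        path is independent of that past, so the values can be frozen in the inner integral.\<close>
      also have "\<dots> = (\<integral>\<^sup>+\<omega>. (\<integral>\<^sup>+\<omega>'. ?\<Phi> ((?X k \<omega>, ?Y k \<omega>), ?w \<omega>') \<partial>M) \<partial>M)"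
      proof (rule nn_integral_indep_set[OF sub _ path])
        show "(\<lambda>\<omega>. (?X k \<omega>, ?Y k \<omega>)) \<in> F (?t k) \<rightarrow>\<^sub>M borel \<Otimes>\<^sub>M borel"
          using XY[of k] by measurable
        show "indep_set (sets (F (?t k))) (sets (vimage_algebra (space M) ?w path_space))"
          using t h by (intro indep_set_increment_path[OF filt sub adapted indep cont]) auto
        let ?N = "(borel \<Otimes>\<^sub>M borel) \<Otimes>\<^sub>M path_space :: (((real ^ 'd) \<times> (real ^ 'd)) \<times> (real \<Rightarrow> real ^ 'm)) measure"
        have [measurable]: "(\<lambda>z. Abar (?t k) (fst (fst z)) h (snd z)) \<in> borel_measurable ?N"
          by (rule measurable_increment_fun_compose[OF Abar]) measurable
        have [measurable]: "(\<lambda>z. Atilde (?t k) (snd (fst z)) h (snd z)) \<in> borel_measurable ?N"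
          by (rule measurable_increment_fun_compose[OF Atilde]) measurable
        show "?\<Phi> \<in> borel_measurable ?N"
          unfolding case_prod_beta by measurable
      qed
      also have "\<dots> \<le> (\<integral>\<^sup>+\<omega>. ennreal (?B (?X k \<omega>) (?Y k \<omega>)) \<partial>M)"
        by (intro nn_integral_mono inner)
      also have "\<dots> = ennreal (\<integral>\<omega>. ?B (?X k \<omega>) (?Y k \<omega>) \<partial>M)"
        using h by (intro nn_integral_eq_integral B_int AE_I2 add_nonneg_nonneg mult_nonneg_nonneg) auto
      finally have "a (Suc k) \<le> (\<integral>\<omega>. ?B (?X k \<omega>) (?Y k \<omega>) \<partial>M)"
        using h by (subst (asm) ennreal_le_iff)
          (auto intro!: integral_nonneg_AE add_nonneg_nonneg mult_nonneg_nonneg)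
      also have "\<dots> = a k * (1 + (\<bar>K3\<bar> + 2 powr q) * h) + h * d powr q * (2 powr q + (3 * c) powr q *
          (1 + moment M (m * q) (?X k) + moment M (m * q) (?Y k)))"
        using int[of k] K2[OF N h_eq h_le, of k] that
        by (simp add: finite_moment_def moment_def a_def prob_space)
      also have "\<dots> \<le> a k * (1 + C * h) + h * d powr q * C"
      proof (intro add_mono mult_left_mono mult_right_mono)
        have "(3 * c) powr q * (1 + moment M (m * q) (?X k) + moment M (m * q) (?Y k)) \<le> (3 * c) powr q * (1 + K2)"
          using K2[OF N h_eq h_le, of k] that by (intro mult_left_mono) auto
        then show "2 powr q + (3 * c) powr q * (1 + moment M (m * q) (?X k) + moment M (m * q) (?Y k)) \<le> C"
          unfolding C_def using powr_ge_zero[of 2 q] abs_ge_zero[of K3] by linarith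
        have "0 \<le> 2 powr q + (3 * c) powr q * (1 + K2)"
          using \<open>0 < K2\<close> by (intro add_nonneg_nonneg mult_nonneg_nonneg) auto
        then show "\<bar>K3\<bar> + 2 powr q \<le> C" unfolding C_def by linarith
        show "0 \<le> a k" by (simp add: a_def)
        show "0 \<le> h * d powr q" using h by simp
      qed (use h in simp_all)
      finally show ?thesis by (simp add: mult_ac)
    qed
    \<comment> \<open>Gronwall with rate \<open>C * h\<close> and level \<open>d powr q\<close>;
      \<open>a 0 = 0\<close> because both chains start at \<open>X0\<close>. The exponent stays
      bounded since \<open>real k * h\<close> is at most \<open>T - t0\<close>.\<close>
    have "a k \<le> exp (C * h * real k) * d powr q"
      using C0 h k step by (intro discrete_gronwall[where n = N]) (auto simp: a_def)
    also have "\<dots> \<le> exp (C * (T - t0)) * d powr q"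
    proof -
      have "C * (h * real k) \<le> C * (T - t0)"
        using k h C0 unfolding Nh[symmetric] by (intro mult_left_mono) auto
      then show ?thesis by (intro mult_right_mono) (simp_all add: mult.assoc)
    qed
    finally have "a k powr (1 / q) \<le> (exp (C * (T - t0)) * d powr q) powr (1 / q)"
      using q2 by (intro powr_mono2) (auto simp: a_def)
    also have "\<dots> = K * d"
      using q2 by (simp add: powr_mult powr_powr K_def d_def)
    finally show "finite_moment M (2 * p) (\<lambda>\<omega>. ?X k \<omega> - ?Y k \<omega>) \<and>
        (moment M (2 * p) (\<lambda>\<omega>. ?X k \<omega> - ?Y k \<omega>)) powr (1 / (2 * p)) \<le> K * h powr (p2 - 1/2)"
      unfolding finite_moment_def moment_def q_def[symmetric] d_def[symmetric] a_def[symmetric]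
      using int[OF k] by (auto simp: a_def)
  qed
qed

end
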